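(* Let $p,q\ge 0$ be integers with $p+q\ge 2$ and with $p=0$ or $q=0$, and let $d\in\{1,\dots,p+q-1\}$. Then the group $O(p+1,q+1)$, acting on the one-point compactification $N^{p,q}$ of $\mathbb{R}^{p+q}$, acts transitively on the set of $d$-dimensional spheres and affine planes in $\mathbb{R}^{p+q}$ (affine planes being regarded as subsets of $N^{p,q}$ via their closures, i.e. together with the point at infinity). That is, every element of $O(p+1,q+1)$ maps each such subset of $N^{p,q}$ to such a subset, and any such subset can be mapped onto any other one by some element of $O(p+1,q+1)$.
   Context: $\mathbb{R}^{p,q}$ is $\mathbb{R}^{p+q}$ with the quadratic form $Q(x)=x_1^2+\cdots+x_p^2-x_{p+1}^2-\cdots-x_{p+q}^2$. $\mathbb{R}^{p+1,q+1}$ is $\mathbb{R}^{p+q+2}$ with coordinates $\xi=(\xi_0,\dots,\xi_{p+q+1})$ and quadratic form $\hat Q(\xi)=\xi_0^2+\xi_1^2+\cdots+\xi_p^2-\xi_{p+1}^2-\cdots-\xi_{p+q+1}^2$. $O(p+1,q+1)$ is the group of invertible linear maps of $\mathbb{R}^{p+q+2}$ preserving $\hat Q$. $N^{p,q}=\{[\xi]\in\mathbb{R}P^{p+q+1}:\hat Q(\xi)=0\}$, on which $O(p+1,q+1)$ acts through its linear action. $\mathbb{R}^{p,q}$ is embedded in $N^{p,q}$ by $\iota(x)=\left[\frac{1-Q(x)}{2}:x_1:\cdots:x_{p+q}:\frac{1+Q(x)}{2}\right]$, with dense image. When $p=0$ or $q=0$, the complement $N^{p,q}\setminus\iota(\mathbb{R}^{p,q})$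 is a single point ("infinity"), and $N^{p,q}$ is the one-point compactification of $\mathbb{R}^{p+q}$. In this case spheres and affine planes are those of Euclidean space $\mathbb{R}^{p+q}$: a $d$-dimensional affine plane is a $d$-dimensional affine subspace, and a $d$-dimensional sphere is a round sphere of positive radius in a $(d+1)$-dimensional affine subspace. They are identified with subsets of $N^{p,q}$ by taking the closure of their image under $\iota$ (this adds the point at infinity to affine planes). *)

theory Defs
  imports "HOL-Analysis.Analysis" "HOL-Algebra.Group_Action"
begin

text \<open>
  The coordinates of the space of dimension p + q are indexed by a finite linearly ordered
  type of cardinality p + q. The number q is determined by p and this cardinality, so only p
  is a parameter of the definitions. The first p indices carry the sign + and the others
  the sign -.
\<close>

definition quad_form :: "nat \<Rightarrow> (real, 'n::{finite,linorder}) vec \<Rightarrow> real" where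
  "quad_form p x =
     (\<Sum>i\<in>UNIV. if card {j. j < i} < p then (x $ i)\<^sup>2 else - (x $ i)\<^sup>2)"

text \<open>
  A triple \<open>(a, x, b)\<close> stands for the coordinate vector
  \<open>(\<xi>\<^sub>0, \<dots>, \<xi>\<^bsub>p+q+1\<^esub>)\<close> with \<open>\<xi>\<^sub>0 = a\<close>, \<open>\<xi>\<^bsub>p+q+1\<^esub> = b\<close> and the middle
  coordinates given by \<open>x\<close>.
\<close>

type_synonym 'n ambient = "real \<times> (real, 'n) vec \<times> real"

definition quad_form_hat :: "nat \<Rightarrow> 'n::{finite,linorder} ambient \<Rightarrow> real" where
  "quad_form_hat p = (\<lambda>(a, x, b). a\<^sup>2 + quad_form p x - b\<^sup>2)"

definition orthogonal_group ::
    "nat \<Rightarrow> ('n::{finite,linorder} ambient \<Rightarrow> 'n ambient) monoid" where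
  "orthogonal_group p =
     \<lparr>carrier = {g. linear g \<and> bij g \<and> (\<forall>\<xi>. quad_form_hat p (g \<xi>) = quad_form_hat p \<xi>)},
      mult = (\<circ>), one = id\<rparr>"

text \<open>
  A point \<open>[\<xi>]\<close> of real projective space is the line \<open>span {\<xi>}\<close> with \<open>\<xi> \<noteq> 0\<close>, and the
  topology is the quotient topology.
\<close>

definition projective_space :: "'a::euclidean_space set set" where
  "projective_space = {span {\<xi>} | \<xi>. \<xi> \<noteq> 0}"

definition projective_topology :: "'a::euclidean_space set topology" where
  "projective_topology =
     topology (\<lambda>U. U \<subseteq> projective_space \<and> open {\<xi>. \<xi> \<noteq> 0 \<and> span {\<xi>} \<in> U})"

lemma openin_projective_topology:
  "openin projective_topology U \<longleftrightarrow>
     U \<subseteq> projective_space \<and> open {\<xi>::'a::euclidean_space. \<xi> \<noteq> 0 \<and> span {\<xi>} \<in> U}"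
proof -
  let ?P = "\<lambda>U. {\<xi>::'a. \<xi> \<noteq> 0 \<and> span {\<xi>} \<in> U}"
  have "istopology (\<lambda>U. U \<subseteq> projective_space \<and> open (?P U))"
    unfolding istopology_def
  proof (intro conjI allI impI)
    fix S T :: "'a set set"
    assume "S \<subseteq> projective_space \<and> open (?P S)" "T \<subseteq> projective_space \<and> open (?P T)"
    moreover have "?P (S \<inter> T) = ?P S \<inter> ?P T" by auto
    ultimately show "S \<inter> T \<subseteq> projective_space" "open (?P (S \<inter> T))" by auto
  next
    fix K :: "'a set set set"
    assume K: "\<forall>S\<in>K. S \<subseteq> projective_space \<and> open (?P S)"
    have "?P (\<Union>K) = (\<Union>S\<in>K. ?P S)" by auto
    with K show "\<Union>K \<subseteq> projective_space" "open (?P (\<Union>K))" by auto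
  qed
  then show ?thesis by (simp add: projective_topology_def topology_inverse')
qed

lemma topspace_projective_topology: "topspace projective_topology = projective_space"
proof
  show "topspace projective_topology \<subseteq> projective_space"
    using openin_projective_topology openin_topspace by blast
  have "{\<xi>::'a. \<xi> \<noteq> 0 \<and> span {\<xi>} \<in> projective_space} = - {0}"
    by (auto simp: projective_space_def)
  then have "openin projective_topology (projective_space :: 'a set set)"
    by (simp add: openin_projective_topology open_Compl)
  then show "projective_space \<subseteq> topspace (projective_topology :: 'a set topology)"
    by (rule openin_subset)
qed

lemma quotient_map_projective_topology:
  "quotient_map (top_of_set (- {0 :: 'a::euclidean_space})) projective_topology (\<lambda>\<xi>. span {\<xi>})"
  unfolding quotient_map_def topspace_projective_topology
proof (intro conjI allI impI)
  show "(\<lambda>\<xi>::'a. span {\<xi>}) ` topspace (top_of_set (- {0})) = projective_space"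
    by (auto simp: projective_space_def)
  fix U :: "'a set set"
  assume "U \<subseteq> projective_space"
  moreover have "{\<xi> \<in> topspace (top_of_set (- {0})). span {\<xi>} \<in> U} = {\<xi>. \<xi> \<noteq> 0 \<and> span {\<xi>} \<in> U}"
    by auto
  moreover have "{\<xi>. \<xi> \<noteq> 0 \<and> span {\<xi>} \<in> U} \<subseteq> - {0}" by auto
  ultimately show "openin (top_of_set (- {0})) {\<xi> \<in> topspace (top_of_set (- {0})). span {\<xi>} \<in> U}
      = openin projective_topology U"
    by (simp add: openin_projective_topology openin_open_eq open_Compl)
qed

definition quadric :: "nat \<Rightarrow> 'n::{finite,linorder} ambient set set" where
  "quadric p = {span {\<xi>} | \<xi>. \<xi> \<noteq> 0 \<and> quad_form_hat p \<xi> = 0}"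

definition quadric_topology :: "nat \<Rightarrow> 'n::{finite,linorder} ambient set topology" where
  "quadric_topology p = subtopology projective_topology (quadric p)"

text \<open>Since points are lines, the image of \<open>[\<xi>]\<close> under a linear map \<open>g\<close> is \<open>g ` [\<xi>]\<close>.\<close>

definition proj_map :: "('a::euclidean_space \<Rightarrow> 'a) \<Rightarrow> 'a set \<Rightarrow> 'a set" where
  "proj_map g L = g ` L"

lemma proj_map_span: "linear g \<Longrightarrow> proj_map g (span {\<xi>}) = span {g \<xi>}"
  by (simp add: proj_map_def linear_span_image[symmetric])

definition quadric_embedding ::
    "nat \<Rightarrow> (real, 'n::{finite,linorder}) vec \<Rightarrow> 'n ambient set" where
  "quadric_embedding p x = span {((1 - quad_form p x) / 2, x, (1 + quad_form p x) / 2)}"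

lemma quadric_embedding_in_quadric: "quadric_embedding p x \<in> quadric p"
proof -
  let ?\<xi> = "((1 - quad_form p x) / 2, x, (1 + quad_form p x) / 2)"
  have "?\<xi> \<noteq> 0" by (auto simp: zero_prod_def)
  moreover have "quad_form_hat p ?\<xi> = 0"
    by (simp add: quad_form_hat_def power2_eq_square field_simps)
  ultimately show ?thesis unfolding quadric_embedding_def quadric_def by blast
qed

definition affine_planes :: "nat \<Rightarrow> 'a::euclidean_space set set" where
  "affine_planes d = {A. affine A \<and> aff_dim A = int d}"

definition round_spheres :: "nat \<Rightarrow> 'a::euclidean_space set set" where
  "round_spheres d = {W \<inter> sphere c r | W c r.
     affine W \<and> aff_dim W = int (d + 1) \<and> c \<in> W \<and> r > 0}"

definition spheres_and_planes :: "nat \<Rightarrow> nat \<Rightarrow> 'n::{finite,linorder} ambient set set set" where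
  "spheres_and_planes p d =
     {quadric_topology p closure_of (quadric_embedding p ` S) | S.
        S \<in> round_spheres d \<union> affine_planes d}"

end

theory Submission
  imports Defs
begin

text \<open>
  If \<open>p = 0\<close> or \<open>q = 0\<close>, the ambient form is, up to a global sign \<open>s\<close>, a Lorentz form: it is
  negative definite on a line and positive definite on a complement. In suitable coordinates
  \<open>(u, x, v)\<close> it becomes \<open>x \<bullet> x - u v\<close>, and the embedding becomes
  \<open>x \<mapsto> [1 : x : x \<bullet> x]\<close>. The equation of a sphere is linear in \<open>x\<close> and
  \<open>x \<bullet> x\<close>, so spheres and planes of dimension \<open>d\<close> are sections of this paraboloid by linear
  subspaces of dimension \<open>d + 2\<close>. The subspaces that occur are exactly those that contain a
  timelike vector, one at which the Lorentz form is negative; for a sphere this expresses that the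
  squared radius is positive (\<open>spheres_and_planes_iff_section\<close>). The section is a plane if the
  subspace contains the null vector \<open>(0, 0, 1)\<close> at infinity and a sphere otherwise, and the closure
  in the quadric consists in both cases of all null lines of the subspace. Thus the
  spheres and planes are the families of null lines of the subspaces of dimension \<open>d + 2\<close> that
  contain a timelike vector (\<open>spheres_and_planes_eq_null_lines\<close>).

  Linear isometries preserve the dimension and timelike vectors, so the orthogonal group acts on this
  set. Transitivity is a case of Witt's theorem, \<open>lorentz_isometries_transitive\<close>, proved with
  reflections: one reflection moves a timelike line of \<open>W\<close> to a fixed timelike axis, and if
  two subspaces of equal dimension contain this axis, reflections that fix their intersection
  increase it until they agree.
\<close>

section \<open>Isometries and reflections of a quadratic form\<close>

definition form_isometry :: "('a::real_vector \<Rightarrow> real) \<Rightarrow> ('a \<Rightarrow> 'a) \<Rightarrow> bool" where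
  "form_isometry Q g \<longleftrightarrow> linear g \<and> bij g \<and> (\<forall>\<xi>. Q (g \<xi>) = Q \<xi>)"

lemma form_isometry_id: "form_isometry Q id"
  by (simp add: form_isometry_def linear_id)

lemma form_isometry_comp:
  assumes "form_isometry Q g" "form_isometry Q h"
  shows "form_isometry Q (g \<circ> h)"
  using assms by (auto simp: form_isometry_def intro: linear_compose bij_comp)

lemma form_isometry_inv:
  fixes g :: "'a::euclidean_space \<Rightarrow> 'a"
  assumes "form_isometry Q g"
  shows "form_isometry Q (inv_into UNIV g)"
proof -
  have g: "linear g" "bij g" "\<And>\<xi>. Q (g \<xi>) = Q \<xi>"
    using assms by (auto simp: form_isometry_def)
  have "linear (inv_into UNIV g)"
    using g(1,2) by (simp add: inj_linear_imp_inv_linear bij_is_inj)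
  moreover have "Q (inv_into UNIV g \<xi>) = Q \<xi>" for \<xi>
    using g(3)[of "inv_into UNIV g \<xi>"] g(2) by (simp add: bij_is_surj surj_f_inv_f)
  ultimately show ?thesis
    using g(2) by (simp add: form_isometry_def bij_imp_bij_inv)
qed

lemma form_isometry_dim_image:
  fixes g :: "'a::euclidean_space \<Rightarrow> 'a"
  assumes "form_isometry Q g"
  shows "dim (g ` V) = dim V"
  using assms by (auto simp: form_isometry_def intro!: dim_image_eq intro: inj_on_subset bij_is_inj)

definition reflection :: "('a::real_vector \<Rightarrow> 'a \<Rightarrow> real) \<Rightarrow> 'a \<Rightarrow> 'a \<Rightarrow> 'a" where
  "reflection \<beta> \<eta> \<xi> = \<xi> - (2 * \<beta> \<xi> \<eta> / \<beta> \<eta> \<eta>) *\<^sub>R \<eta>"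

lemma form_isometry_reflection:
  assumes \<beta>: "bilinear \<beta>" and sym: "\<And>\<xi> \<eta>. \<beta> \<xi> \<eta> = \<beta> \<eta> \<xi>" and \<eta>: "\<beta> \<eta> \<eta> \<noteq> 0"
  shows "form_isometry (\<lambda>\<xi>. \<beta> \<xi> \<xi>) (reflection \<beta> \<eta>)"
proof -
  note simps = bilinear_ladd[OF \<beta>] bilinear_lsub[OF \<beta>] bilinear_rsub[OF \<beta>]
    bilinear_lmul[OF \<beta>] bilinear_rmul[OF \<beta>]
  have "linear (reflection \<beta> \<eta>)"
    by (rule linearI)
      (simp_all add: reflection_def simps scaleR_diff_right add_divide_distrib scaleR_add_left
        distrib_left)
  moreover have "reflection \<beta> \<eta> (reflection \<beta> \<eta> \<xi>) = \<xi>" for \<xi>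
    using \<eta> by (simp add: reflection_def simps diff_divide_distrib scaleR_diff_left)
  then have "bij (reflection \<beta> \<eta>)"
    by (rule involuntory_imp_bij)
  moreover have "\<beta> (reflection \<beta> \<eta> \<xi>) (reflection \<beta> \<eta> \<xi>) = \<beta> \<xi> \<xi>" for \<xi>
    using \<eta> by (simp add: reflection_def simps sym[of \<eta> \<xi>])
  ultimately show ?thesis
    by (simp add: form_isometry_def)
qed

lemma reflection_eq_self: "\<beta> \<xi> \<eta> = 0 \<Longrightarrow> reflection \<beta> \<eta> \<xi> = \<xi>"
  by (simp add: reflection_def)

text \<open>The hyperplane orthogonal to \<open>\<xi> - \<zeta>\<close> is the perpendicular bisector of two vectors of
  equal length, so the reflection in it exchanges them. All isometries that the transitivity
  proof needs are composed of such reflections.\<close>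

lemma reflection_difference:
  assumes \<beta>: "bilinear \<beta>" and sym: "\<And>\<xi> \<eta>. \<beta> \<xi> \<eta> = \<beta> \<eta> \<xi>"
    and eq: "\<beta> \<xi> \<xi> = \<beta> \<zeta> \<zeta>" and nz: "\<beta> (\<xi> - \<zeta>) (\<xi> - \<zeta>) \<noteq> 0"
  shows "reflection \<beta> (\<xi> - \<zeta>) \<xi> = \<zeta>"
proof -
  have "2 * \<beta> \<xi> (\<xi> - \<zeta>) = \<beta> (\<xi> - \<zeta>) (\<xi> - \<zeta>)"
    using eq by (simp add: bilinear_lsub[OF \<beta>] bilinear_rsub[OF \<beta>] sym[of \<zeta> \<xi>])
  with nz show ?thesis
    by (simp add: reflection_def)
qed

section \<open>Lorentzian subspaces\<close>

text \<open>For a unit vector \<open>\<tau>\<close> this form has signature \<open>(n, 1)\<close>: it reverses the sign of the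
  inner product on the line of \<open>\<tau>\<close> and keeps it on the orthogonal complement. Writing the form
  through the inner product makes Euclidean orthogonal complements available.\<close>

definition lorentz_form :: "'a::euclidean_space \<Rightarrow> 'a \<Rightarrow> 'a \<Rightarrow> real" where
  "lorentz_form \<tau> \<xi> \<eta> = \<xi> \<bullet> \<eta> - 2 * (\<xi> \<bullet> \<tau>) * (\<eta> \<bullet> \<tau>)"

lemma bilinear_lorentz_form: "bilinear (lorentz_form \<tau>)"
  unfolding bilinear_def lorentz_form_def
  by (auto intro!: linearI simp: algebra_simps)

lemma lorentz_form_commute: "lorentz_form \<tau> \<xi> \<eta> = lorentz_form \<tau> \<eta> \<xi>"
  by (simp add: lorentz_form_def inner_commute)

abbreviation lorentz_isometry :: "'a::euclidean_space \<Rightarrow> ('a \<Rightarrow> 'a) \<Rightarrow> bool" where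
  "lorentz_isometry \<tau> \<equiv> form_isometry (\<lambda>\<xi>. lorentz_form \<tau> \<xi> \<xi>)"

lemma lorentz_isometry_reflection:
  "lorentz_form \<tau> \<eta> \<eta> \<noteq> 0 \<Longrightarrow> lorentz_isometry \<tau> (reflection (lorentz_form \<tau>) \<eta>)"
  by (rule form_isometry_reflection[OF bilinear_lorentz_form lorentz_form_commute])

text \<open>After normalisation the timelike vector \<open>\<xi>\<close> has the same length as \<open>\<tau>\<close>, and
  \<open>\<xi> - \<tau>\<close> and \<open>\<xi> + \<tau>\<close> are not both null because the values of the form at them add up to
  \<open>-4\<close>. Hence one of the two corresponding reflections takes \<open>\<xi>\<close> to \<open>\<tau>\<close> or to \<open>- \<tau>\<close>.\<close>

lemma timelike_subspace_to_standard:
  fixes V :: "'a::euclidean_space set"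
  assumes \<tau>: "norm \<tau> = 1" and V: "subspace V"
    and \<xi>0: "\<xi>0 \<in> V" "lorentz_form \<tau> \<xi>0 \<xi>0 < 0"
  obtains g where "lorentz_isometry \<tau> g" "\<tau> \<in> g ` V"
proof -
  let ?B = "lorentz_form \<tau>"
  define \<xi> where "\<xi> = (1 / sqrt (- ?B \<xi>0 \<xi>0)) *\<^sub>R \<xi>0"
  have "\<xi> \<in> V"
    using V \<xi>0 by (simp add: \<xi>_def subspace_scale)
  have \<xi>: "?B \<xi> \<xi> = - 1"
  proof -
    have "?B \<xi> \<xi> = (1 / sqrt (- ?B \<xi>0 \<xi>0))\<^sup>2 * ?B \<xi>0 \<xi>0"
      by (simp add: \<xi>_def bilinear_lmul[OF bilinear_lorentz_form]
          bilinear_rmul[OF bilinear_lorentz_form] power2_eq_square)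
    then show ?thesis
      using \<xi>0(2) by (simp add: power_divide)
  qed
  have "\<tau> \<bullet> \<tau> = 1"
    using \<tau> by (simp add: norm_eq_1)
  then have \<tau>\<tau>: "?B \<tau> \<tau> = - 1" "?B (- \<tau>) (- \<tau>) = - 1"
    by (simp_all add: lorentz_form_def)
  have sum: "?B (\<xi> - \<tau>) (\<xi> - \<tau>) + ?B (\<xi> - - \<tau>) (\<xi> - - \<tau>) = - 4"
    using \<xi> \<tau>\<tau> by (simp add: bilinear_lsub[OF bilinear_lorentz_form]
        bilinear_rsub[OF bilinear_lorentz_form] bilinear_ladd[OF bilinear_lorentz_form]
        bilinear_radd[OF bilinear_lorentz_form])
  obtain \<zeta> where \<zeta>: "\<zeta> = \<tau> \<or> \<zeta> = - \<tau>" "?B (\<xi> - \<zeta>) (\<xi> - \<zeta>) \<noteq> 0"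
  proof (cases "?B (\<xi> - \<tau>) (\<xi> - \<tau>) = 0")
    case True
    with sum have "?B (\<xi> - - \<tau>) (\<xi> - - \<tau>) \<noteq> 0" by linarith
    then show ?thesis using that by blast
  qed (use that in blast)
  let ?g = "reflection ?B (\<xi> - \<zeta>)"
  have g: "lorentz_isometry \<tau> ?g"
    using \<zeta>(2) by (rule lorentz_isometry_reflection)
  then have "subspace (?g ` V)"
    using V by (simp add: form_isometry_def linear_subspace_image)
  moreover have "?g \<xi> = \<zeta>"
    using \<zeta> \<xi> \<tau>\<tau> by (intro reflection_difference bilinear_lorentz_form lorentz_form_commute) auto
  then have "\<zeta> \<in> ?g ` V"
    using \<open>\<xi> \<in> V\<close> by force
  ultimately have "\<tau> \<in> ?g ` V"
    using \<zeta>(1) by (metis minus_minus subspace_neg)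
  with g show ?thesis by (rule that)
qed

text \<open>A unit vector \<open>v\<close> of \<open>V\<close> and a unit vector \<open>v'\<close> of \<open>V'\<close>, both Euclidean-orthogonal to
  \<open>V \<inter> V'\<close>, are orthogonal to \<open>\<tau>\<close>. On the orthogonal complement of \<open>\<tau>\<close> the Lorentz form is
  the inner product, so the reflection exchanging \<open>v\<close> and \<open>v'\<close> exists and fixes \<open>V \<inter> V'\<close>.
  It enlarges the intersection, which is the induction step.\<close>

lemma lorentz_isometry_between_subspaces_through:
  fixes V V' :: "'a::euclidean_space set"
  assumes "subspace V" "subspace V'" "dim V = dim V'" "\<tau> \<in> V" "\<tau> \<in> V'"
  shows "\<exists>g. lorentz_isometry \<tau> g \<and> g ` V = V'"
  using assms
proof (induction "dim V - dim (V \<inter> V')" arbitrary: V rule: less_induct)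
  case less
  let ?B = "lorentz_form \<tau>" and ?K = "V \<inter> V'"
  have K: "subspace ?K"
    using less.prems by (simp add: subspace_inter)
  show ?case
  proof (cases "V = V'")
    case True
    then show ?thesis
      using form_isometry_id by (metis image_id id_apply)
  next
    case False
    have unit_vector: "\<exists>v\<in>W. norm v = 1 \<and> (\<forall>k\<in>?K. k \<bullet> v = 0)"
      if W: "subspace W" "?K \<subset> W" for W
    proof -
      have span: "span W = W" "span ?K = ?K"
        using W K by (simp_all add: span_eq_iff)
      then have "span ?K \<subset> span W"
        using W(2) by metis
      then obtain v where "v \<noteq> 0" "v \<in> span W" "\<And>k. k \<in> span ?K \<Longrightarrow> orthogonal v k"
        by (rule orthogonal_to_subspace_exists_gen) (rule that)
      then have "(1 / norm v) *\<^sub>R v \<in> W" "norm ((1 / norm v) *\<^sub>R v) = 1"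
        and "\<forall>k\<in>?K. k \<bullet> ((1 / norm v) *\<^sub>R v) = 0"
        using W(1) by (auto simp: span subspace_scale orthogonal_def inner_commute)
      then show ?thesis by blast
    qed
    have "?K \<noteq> V" "?K \<noteq> V'"
      using False less.prems(1-3) subspace_dim_equal[of V V'] subspace_dim_equal[of V' V]
      by auto
    then have proper: "?K \<subset> V" "?K \<subset> V'"
      by auto
    obtain v where v: "v \<in> V" "norm v = 1" "\<And>k. k \<in> ?K \<Longrightarrow> k \<bullet> v = 0"
      using unit_vector[OF less.prems(1) proper(1)] by auto
    obtain v' where v': "v' \<in> V'" "norm v' = 1" "\<And>k. k \<in> ?K \<Longrightarrow> k \<bullet> v' = 0"
      using unit_vector[OF less.prems(2) proper(2)] by auto
    have "\<tau> \<bullet> v = 0" "\<tau> \<bullet> v' = 0"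
      using v v' less.prems by blast+
    then have \<tau>: "v \<bullet> \<tau> = 0" "v' \<bullet> \<tau> = 0"
      by (simp_all add: inner_commute)
    have "v' \<notin> ?K"
      using v' by force
    then have "v \<noteq> v'"
      using v v' by blast
    moreover have "(v - v') \<bullet> \<tau> = 0"
      using \<tau> by (simp add: inner_diff_left)
    ultimately have pos: "?B (v - v') (v - v') \<noteq> 0"
      by (simp add: lorentz_form_def)
    let ?g = "reflection ?B (v - v')"
    have g: "lorentz_isometry \<tau> ?g"
      using pos by (rule lorentz_isometry_reflection)
    have gv: "?g v = v'"
    proof (rule reflection_difference[OF bilinear_lorentz_form lorentz_form_commute _ pos])
      show "?B v v = ?B v' v'"
        using v(2) v'(2) \<tau> by (simp add: lorentz_form_def norm_eq_1)
    qed
    have gK: "?g k = k" if "k \<in> ?K" for k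
      using v(3)[OF that] v'(3)[OF that] \<open>(v - v') \<bullet> \<tau> = 0\<close>
      by (intro reflection_eq_self) (simp add: lorentz_form_def inner_diff_right)
    have gV: "subspace (?g ` V)" "dim (?g ` V) = dim V"
      using g less.prems(1)
      by (auto simp: form_isometry_def linear_subspace_image form_isometry_dim_image[OF g])
    have "v' \<in> ?g ` V"
      using imageI[OF v(1), of ?g] gv by simp
    have "k \<in> ?g ` V \<inter> V'" if "k \<in> ?K" for k
      using gK[OF that] that imageI[of k V ?g] by simp
    then have "?K \<subset> ?g ` V \<inter> V'"
      using \<open>v' \<in> ?g ` V\<close> v'(1) \<open>v' \<notin> ?K\<close> by (metis IntI psubsetI subsetI)
    then have "dim ?K < dim (?g ` V \<inter> V')"
      using subspace_dim_equal[OF K subspace_inter[OF gV(1) less.prems(2)]]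
      by (metis linorder_not_less psubsetE)
    moreover have "dim (?g ` V \<inter> V') \<le> dim V"
      using gV(2) dim_subset[of "?g ` V \<inter> V'" "?g ` V"] by simp
    ultimately have "dim (?g ` V) - dim (?g ` V \<inter> V') < dim V - dim ?K"
      using gV(2) by linarith
    moreover have "\<tau> \<in> ?g ` V"
      using gK[of \<tau>] less.prems by force
    ultimately obtain h where h: "lorentz_isometry \<tau> h" "h ` ?g ` V = V'"
      using less.hyps[of "?g ` V"] gV less.prems by auto
    then show ?thesis
      using form_isometry_comp[OF h(1) g] by (metis image_comp)
  qed
qed

text \<open>This is the case of Witt's extension theorem that concerns subspaces of signature
  \<open>(k, 1)\<close>: moving both subspaces so that they contain \<open>\<tau>\<close> reduces it to the case of a common timelike
  vector.\<close>

theorem lorentz_isometries_transitive: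
  fixes V V' :: "'a::euclidean_space set"
  assumes \<tau>: "norm \<tau> = 1" and V: "subspace V" "\<exists>\<xi>\<in>V. lorentz_form \<tau> \<xi> \<xi> < 0"
    and V': "subspace V'" "\<exists>\<xi>\<in>V'. lorentz_form \<tau> \<xi> \<xi> < 0" and dim: "dim V = dim V'"
  shows "\<exists>g. lorentz_isometry \<tau> g \<and> g ` V = V'"
proof -
  obtain h where h: "lorentz_isometry \<tau> h" "\<tau> \<in> h ` V"
    using V(2) by (auto elim: timelike_subspace_to_standard[OF \<tau> V(1)])
  obtain h' where h': "lorentz_isometry \<tau> h'" "\<tau> \<in> h' ` V'"
    using V'(2) by (auto elim: timelike_subspace_to_standard[OF \<tau> V'(1)])
  have "subspace (h ` V)" "subspace (h' ` V')" "dim (h ` V) = dim (h' ` V')"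
    using h(1) h'(1) V(1) V'(1) dim
    by (auto simp: form_isometry_def linear_subspace_image form_isometry_dim_image[OF h(1)]
        form_isometry_dim_image[OF h'(1)])
  then obtain k where k: "lorentz_isometry \<tau> k" "k ` h ` V = h' ` V'"
    using lorentz_isometry_between_subspaces_through h(2) h'(2) by blast
  have "inv_into UNIV h' ` h' ` V' = V'"
    using h'(1) by (simp add: form_isometry_def bij_is_inj image_inv_f_f)
  then have "(inv_into UNIV h' \<circ> (k \<circ> h)) ` V = V'"
    using k(2) by (metis image_comp)
  then show ?thesis
    using form_isometry_comp[OF form_isometry_inv[OF h'(1)] form_isometry_comp[OF k(1) h(1)]]
    by blast
qed

section \<open>Spheres and planes as sections of a paraboloid\<close>

text \<open>The null vectors of this form with first coordinate 1 are the points \<open>(1, x, x \<bullet> x)\<close> of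
  a paraboloid, the homogeneous lift of Euclidean space. The only other null line is spanned by
  \<open>(0, 0, 1)\<close>, which is the point at infinity. The lift turns the quadratic equation of a sphere
  into a linear one.\<close>

definition cone_form :: "real \<times> 'a::euclidean_space \<times> real \<Rightarrow> real" where
  "cone_form = (\<lambda>(u, x, v). x \<bullet> x - u * v)"

lemma timelike_first_coordinate_nonzero:
  assumes "cone_form (u, x, v) < 0"
  shows "u \<noteq> 0"
proof
  assume "u = 0"
  with assms have "x \<bullet> x < 0"
    by (simp add: cone_form_def)
  then show False
    using inner_ge_zero[of x] by linarith
qed

definition section_of_paraboloid :: "(real \<times> 'a::euclidean_space \<times> real) set \<Rightarrow> 'a set" where
  "section_of_paraboloid V = {x. (1, x, x \<bullet> x) \<in> V}"

text \<open>The subspace that cuts out the sphere with center \<open>c\<close> and squared radius \<open>\<rho>\<close> in the affine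
  subspace \<open>c + L\<close>: the vectors \<open>(u, x, v)\<close> with \<open>x - u c \<in> L\<close> satisfying the homogenised
  equation \<open>v - 2 x \<bullet> c + u (c \<bullet> c - \<rho>) = 0\<close> of the sphere, here parametrised by \<open>u\<close> and
  \<open>y = x - u c\<close>.\<close>

definition sphere_space :: "'a::euclidean_space \<Rightarrow> 'a set \<Rightarrow> real \<Rightarrow> (real \<times> 'a \<times> real) set" where
  "sphere_space c L \<rho> =
     (\<lambda>(u, y). (u, u *\<^sub>R c + y, u * (c \<bullet> c + \<rho>) + 2 * (y \<bullet> c))) ` (UNIV \<times> L)"

definition plane_space :: "'a::euclidean_space \<Rightarrow> 'a set \<Rightarrow> (real \<times> 'a \<times> real) set" where
  "plane_space c L = (\<lambda>(u, y, v). (u, u *\<^sub>R c + y, v)) ` (UNIV \<times> L \<times> UNIV)"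

lemma mem_sphere_space:
  "(u, x, v) \<in> sphere_space c L \<rho> \<longleftrightarrow>
     x - u *\<^sub>R c \<in> L \<and> v = u * (c \<bullet> c + \<rho>) + 2 * ((x - u *\<^sub>R c) \<bullet> c)"
  by (force simp: sphere_space_def image_iff)

lemma mem_plane_space: "(u, x, v) \<in> plane_space c L \<longleftrightarrow> x - u *\<^sub>R c \<in> L"
  by (force simp: plane_space_def image_iff)

lemma
  assumes "subspace L"
  shows subspace_sphere_space: "subspace (sphere_space c L \<rho>)"
    and dim_sphere_space: "dim (sphere_space c L \<rho>) = dim L + 1"
proof -
  let ?f = "\<lambda>(u, y). (u, u *\<^sub>R c + y, u * (c \<bullet> c + \<rho>) + 2 * (y \<bullet> c))"
  have f: "linear ?f"
    by (rule linearI) (auto simp: algebra_simps scaleR_add_left inner_add_left)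
  have UL: "subspace (UNIV \<times> L :: (real \<times> 'a) set)"
    using assms by (simp add: subspace_Times)
  show "subspace (sphere_space c L \<rho>)"
    unfolding sphere_space_def by (rule linear_subspace_image[OF f UL])
  have "inj_on ?f (span (UNIV \<times> L))"
    by (rule inj_onI) auto
  then have "dim (sphere_space c L \<rho>) = dim (UNIV \<times> L :: (real \<times> 'a) set)"
    unfolding sphere_space_def by (rule dim_image_eq[OF f])
  then show "dim (sphere_space c L \<rho>) = dim L + 1"
    using assms by (simp add: dim_Times)
qed

lemma
  assumes "subspace L"
  shows subspace_plane_space: "subspace (plane_space c L)"
    and dim_plane_space: "dim (plane_space c L) = dim L + 2"
proof -
  let ?f = "\<lambda>(u, y, v). (u, u *\<^sub>R c + y, v)"
  have f: "linear ?f"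
    by (rule linearI) (auto simp: algebra_simps scaleR_add_left)
  have UL: "subspace (UNIV \<times> L \<times> UNIV :: (real \<times> 'a \<times> real) set)"
    using assms by (simp add: subspace_Times)
  show "subspace (plane_space c L)"
    unfolding plane_space_def by (rule linear_subspace_image[OF f UL])
  have "inj_on ?f (span (UNIV \<times> L \<times> UNIV))"
    by (rule inj_onI) auto
  then have "dim (plane_space c L) = dim (UNIV \<times> L \<times> UNIV :: (real \<times> 'a \<times> real) set)"
    unfolding plane_space_def by (rule dim_image_eq[OF f])
  then show "dim (plane_space c L) = dim L + 2"
    using assms by (simp add: dim_Times subspace_Times)
qed

lemma section_of_sphere_space:
  "section_of_paraboloid (sphere_space c L \<rho>) = {x. x - c \<in> L \<and> (norm (x - c))\<^sup>2 = \<rho>}"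
  by (auto simp: section_of_paraboloid_def mem_sphere_space power2_norm_eq_inner algebra_simps
      inner_diff_left inner_diff_right inner_commute)

lemma section_of_plane_space: "section_of_paraboloid (plane_space c L) = {x. x - c \<in> L}"
  by (simp add: section_of_paraboloid_def mem_plane_space)

text \<open>The next three lemmas describe affine subspaces, and with them planes and spheres, by a base
  point and a direction space, which are the data that \<open>sphere_space\<close> and \<open>plane_space\<close> take.\<close>

lemma affine_iff_translated_subspace:
  fixes W :: "'a::euclidean_space set"
  assumes "c \<in> W"
  shows "affine W \<and> aff_dim W = int d \<longleftrightarrow> (\<exists>L. subspace L \<and> dim L = d \<and> W = {x. x - c \<in> L})"
proof
  assume W: "affine W \<and> aff_dim W = int d"
  let ?L = "(\<lambda>x. x - c) ` W"
  have "subspace ?L" "dim ?L = d"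
    using W assms affine_diffs_subspace_subtract[of W c] aff_dim_dim_affine_diffs[of W c] by auto
  moreover have "W = {x. x - c \<in> ?L}"
    by auto
  ultimately show "\<exists>L. subspace L \<and> dim L = d \<and> W = {x. x - c \<in> L}"
    by blast
next
  assume "\<exists>L. subspace L \<and> dim L = d \<and> W = {x. x - c \<in> L}"
  then obtain L where L: "subspace L" "dim L = d" "W = {x. x - c \<in> L}"
    by blast
  then have "W = (+) c ` L"
    by (auto simp: image_iff) (metis add_diff_cancel_left' diff_add_cancel add.commute)
  then show "affine W \<and> aff_dim W = int d"
    using L(1,2) affine_translation[of L c]
    by (simp only: aff_dim_translation_eq aff_dim_subspace subspace_imp_affine)
qed

lemma affine_planes_iff:
  fixes S :: "'a::euclidean_space set"
  shows "S \<in> affine_planes d \<longleftrightarrow> (\<exists>c L. subspace L \<and> dim L = d \<and> S = {x. x - c \<in> L})"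
proof
  assume S: "S \<in> affine_planes d"
  then have "S \<noteq> {}"
    by (auto simp: affine_planes_def)
  then obtain c where "c \<in> S" by blast
  with S show "\<exists>c L. subspace L \<and> dim L = d \<and> S = {x. x - c \<in> L}"
    using affine_iff_translated_subspace[of c S d] by (auto simp: affine_planes_def)
next
  assume "\<exists>c L. subspace L \<and> dim L = d \<and> S = {x. x - c \<in> L}"
  then obtain c L where L: "subspace L" "dim L = d" "S = {x. x - c \<in> L}"
    by blast
  then have "c \<in> S"
    by (simp add: subspace_0)
  with L show "S \<in> affine_planes d"
    using affine_iff_translated_subspace[of c S d] by (auto simp: affine_planes_def)
qed

lemma round_spheres_iff:
  fixes S :: "'a::euclidean_space set"
  shows "S \<in> round_spheres d \<longleftrightarrow>
    (\<exists>c L \<rho>. subspace L \<and> dim L = d + 1 \<and> \<rho> > 0 \<and> S = {x. x - c \<in> L \<and> (norm (x - c))\<^sup>2 = \<rho>})"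
proof
  assume "S \<in> round_spheres d"
  then obtain W c r where W: "affine W" "aff_dim W = int (d + 1)" "c \<in> W" "r > 0" "S = W \<inter> sphere c r"
    by (auto simp: round_spheres_def)
  then obtain L where L: "subspace L" "dim L = d + 1" "W = {x. x - c \<in> L}"
    using affine_iff_translated_subspace[of c W "d + 1"] by auto
  have radius: "(norm (x - c))\<^sup>2 = r\<^sup>2 \<longleftrightarrow> dist c x = r" for x
    using W(4) by (simp add: dist_norm norm_minus_commute power2_eq_iff_nonneg)
  have "S = {x. x - c \<in> L \<and> (norm (x - c))\<^sup>2 = r\<^sup>2}"
    unfolding W(5) L(3) by (auto simp only: radius mem_sphere)
  with L(1,2) W(4) show "\<exists>c L \<rho>. subspace L \<and> dim L = d + 1 \<and> \<rho> > 0 \<and> S = {x. x - c \<in> L \<and> (norm (x - c))\<^sup>2 = \<rho>}"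
    by (intro exI[of _ c] exI[of _ L] exI[of _ "r\<^sup>2"] conjI) simp_all
next
  assume "\<exists>c L \<rho>. subspace L \<and> dim L = d + 1 \<and> \<rho> > 0 \<and> S = {x. x - c \<in> L \<and> (norm (x - c))\<^sup>2 = \<rho>}"
  then obtain c L \<rho> where L: "subspace L" "dim L = d + 1" "\<rho> > 0"
      "S = {x. x - c \<in> L \<and> (norm (x - c))\<^sup>2 = \<rho>}"
    by blast
  define W where "W = {x. x - c \<in> L}"
  have "c \<in> W"
    using L(1) by (simp add: W_def subspace_0)
  then have W: "affine W" "aff_dim W = int (d + 1)"
    using affine_iff_translated_subspace[of c W "d + 1"] L by (auto simp: W_def)
  have "(norm (x - c))\<^sup>2 = \<rho> \<longleftrightarrow> norm (x - c) = sqrt \<rho>" for x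
    using real_sqrt_unique[of "norm (x - c)" \<rho>] L(3) real_sqrt_pow2[of \<rho>] by auto
  then have radius: "(norm (x - c))\<^sup>2 = \<rho> \<longleftrightarrow> dist c x = sqrt \<rho>" for x
    by (simp add: dist_norm norm_minus_commute[of c x])
  have "S = W \<inter> sphere c (sqrt \<rho>)"
    unfolding L(4) W_def by (auto simp only: radius mem_sphere)
  with W \<open>c \<in> W\<close> L(3) show "S \<in> round_spheres d"
    unfolding round_spheres_def by (auto intro!: exI[of _ W] exI[of _ c] exI[of _ "sqrt \<rho>"])
qed

text \<open>A timelike vector, scaled so that its first coordinate is 1, lies over a point \<open>c\<close>.
  Since \<open>V\<close> contains the direction of the third coordinate, that coordinate is arbitrary on
  \<open>V\<close>, which is then determined by \<open>c\<close> and the directions with first coordinate 0.\<close>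

lemma lorentzian_subspace_with_infinity:
  fixes V :: "(real \<times> 'a::euclidean_space \<times> real) set"
  assumes V: "subspace V" and \<tau>: "\<tau> \<in> V" "cone_form \<tau> < 0" and inf: "(0, 0, 1) \<in> V"
  obtains c L where "subspace L" "V = plane_space c L"
proof -
  obtain u0 x0 v0 where \<tau>_eq: "\<tau> = (u0, x0, v0)"
    by (metis prod_cases3)
  have u0: "u0 \<noteq> 0"
    using \<tau>(2) unfolding \<tau>_eq by (rule timelike_first_coordinate_nonzero)
  define c where "c = (1 / u0) *\<^sub>R x0"
  define L where "L = {y. (0, y, 0) \<in> V}"
  have shift: "(u, x, v + t) \<in> V" if "(u, x, v) \<in> V" for u x v t
    using subspace_add[OF V that subspace_scale[OF V inf, of t]] by simp
  have "(1 / u0) *\<^sub>R \<tau> \<in> V"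
    by (rule subspace_scale[OF V \<tau>(1)])
  then have c: "(1, c, 0) \<in> V"
    using u0 shift[of 1 c "v0 / u0" "- v0 / u0"] by (simp add: \<tau>_eq c_def)
  have L: "subspace L"
    unfolding subspace_def
  proof (intro conjI ballI allI)
    show "0 \<in> L"
      using subspace_0[OF V] by (simp add: L_def zero_prod_def)
    fix x y assume "x \<in> L" "y \<in> L"
    then show "x + y \<in> L"
      using subspace_add[OF V, of "(0, x, 0)" "(0, y, 0)"] by (simp add: L_def)
    show "a *\<^sub>R x \<in> L" for a
      using subspace_scale[OF V, of "(0, x, 0)" a] \<open>x \<in> L\<close> by (simp add: L_def)
  qed
  have "(u, x, v) \<in> V \<longleftrightarrow> x - u *\<^sub>R c \<in> L" for u x v
  proof
    assume "(u, x, v) \<in> V"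
    from subspace_diff[OF V this subspace_scale[OF V c, of u]] show "x - u *\<^sub>R c \<in> L"
      using shift[of 0 "x - u *\<^sub>R c" v "- v"] by (simp add: L_def)
  next
    assume "x - u *\<^sub>R c \<in> L"
    then have "(0, x - u *\<^sub>R c, 0) \<in> V"
      by (simp add: L_def)
    from subspace_add[OF V this subspace_scale[OF V c, of u]] show "(u, x, v) \<in> V"
      using shift[of u x 0 v] by simp
  qed
  then have "V = plane_space c L"
    by (auto simp: mem_plane_space)
  with L show ?thesis by (rule that)
qed

text \<open>Now the third coordinate is a linear function of the direction \<open>y\<close> on the vectors
  \<open>(0, y, v)\<close> of \<open>V\<close>. It has the form \<open>2 (y \<bullet> m)\<close>, and the center is the point \<open>c\<close> of the
  affine subspace under \<open>V\<close> for which \<open>c - m\<close> is orthogonal to the direction space \<open>L\<close>. In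
  the resulting coordinates the form is \<open>y \<bullet> y - \<rho> u\<^sup>2\<close>, and a timelike vector exists only if
  the squared radius \<open>\<rho>\<close> is positive.\<close>

lemma lorentzian_subspace_without_infinity:
  fixes V :: "(real \<times> 'a::euclidean_space \<times> real) set"
  assumes V: "subspace V" and \<tau>: "\<tau> \<in> V" "cone_form \<tau> < 0" and inf: "(0, 0, 1) \<notin> V"
  obtains c L \<rho> where "subspace L" "\<rho> > 0" "V = sphere_space c L \<rho>"
proof -
  obtain u0 x0 v0 where \<tau>_eq: "\<tau> = (u0, x0, v0)"
    by (metis prod_cases3)
  have u0: "u0 \<noteq> 0"
    using \<tau>(2) unfolding \<tau>_eq by (rule timelike_first_coordinate_nonzero)
  define V0 where "V0 = {(y, v). (0, y, v) \<in> V}"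
  have V0: "subspace V0"
    unfolding subspace_def
  proof (intro conjI ballI allI)
    show "0 \<in> V0"
      using subspace_0[OF V] by (simp add: V0_def zero_prod_def)
    fix x y assume "x \<in> V0" "y \<in> V0"
    then show "x + y \<in> V0"
      using subspace_add[OF V, of "(0, x)" "(0, y)"] by (auto simp: V0_def)
    show "a *\<^sub>R x \<in> V0" for a
      using subspace_scale[OF V, of "(0, x)" a] \<open>x \<in> V0\<close> by (auto simp: V0_def)
  qed
  \<comment> \<open>The part of \<open>(0, 1)\<close> orthogonal to \<open>V0\<close> is a normal vector \<open>(k1, k2)\<close> of \<open>V0\<close> with
    \<open>k2 \<noteq> 0\<close>; solving the equation of its hyperplane for \<open>v\<close> gives \<open>m\<close>.\<close>
  obtain f k where f: "f \<in> span V0" and k: "\<And>w. w \<in> span V0 \<Longrightarrow> orthogonal k w"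
    and fk: "(0, 1) = f + k"
    by (rule orthogonal_subspace_decomp_exists[of V0 "(0, 1)"]) (rule that)
  have spanV0: "span V0 = V0"
    using V0 by (simp add: span_eq_iff)
  have "k \<noteq> 0"
  proof
    assume "k = 0"
    with f fk have "(0, 1) \<in> V0"
      by (simp only: spanV0 add_0_right)
    with inf show False
      by (simp add: V0_def)
  qed
  obtain k1 k2 where k_eq: "k = (k1, k2)"
    by fastforce
  have "k2 = k \<bullet> (0, 1)"
    by (simp add: k_eq)
  also have "\<dots> = k \<bullet> k"
    using k[OF f] by (simp add: fk inner_add_right orthogonal_def)
  finally have "k2 \<noteq> 0"
    using \<open>k \<noteq> 0\<close> by simp
  define m where "m = (- 1 / (2 * k2)) *\<^sub>R k1"
  have height: "v = 2 * (y \<bullet> m)" if "(0, y, v) \<in> V" for y v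
  proof -
    have "(y, v) \<in> span V0"
      unfolding spanV0 using that by (simp add: V0_def)
    then have "k1 \<bullet> y + k2 * v = 0"
      using k by (force simp: k_eq orthogonal_def)
    then show ?thesis
      using \<open>k2 \<noteq> 0\<close> by (simp add: m_def field_simps inner_commute)
  qed
  define L where "L = {y. (0, y, 2 * (y \<bullet> m)) \<in> V}"
  have L: "subspace L"
    unfolding subspace_def
  proof (intro conjI ballI allI)
    show "0 \<in> L"
      using subspace_0[OF V] by (simp add: L_def zero_prod_def)
    fix x y assume "x \<in> L" "y \<in> L"
    then show "x + y \<in> L"
      using subspace_add[OF V, of "(0, x, 2 * (x \<bullet> m))" "(0, y, 2 * (y \<bullet> m))"]
      by (simp add: L_def inner_add_left distrib_left)
    show "a *\<^sub>R x \<in> L" for a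
      using subspace_scale[OF V, of "(0, x, 2 * (x \<bullet> m))" a] \<open>x \<in> L\<close>
      by (simp add: L_def mult.left_commute)
  qed
  define c0 where "c0 = (1 / u0) *\<^sub>R x0"
  obtain l z where l: "l \<in> span L" and z: "\<And>w. w \<in> span L \<Longrightarrow> orthogonal z w"
    and lz: "m - c0 = l + z"
    by (rule orthogonal_subspace_decomp_exists[of L "m - c0"]) (rule that)
  have spanL: "span L = L"
    using L by (simp add: span_eq_iff)
  define c where "c = c0 + l"
  have "c = m - z"
    using lz by (simp add: c_def algebra_simps)
  then have ym: "y \<bullet> m = y \<bullet> c" if "y \<in> L" for y
    using z[of y] that by (simp add: spanL inner_diff_right orthogonal_def inner_commute)
  define v1 where "v1 = v0 / u0 + 2 * (l \<bullet> m)"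
  have "(1 / u0) *\<^sub>R \<tau> \<in> V"
    by (rule subspace_scale[OF V \<tau>(1)])
  moreover have "(0, l, 2 * (l \<bullet> m)) \<in> V"
    using l unfolding spanL by (simp add: L_def)
  ultimately have "(1 / u0) *\<^sub>R \<tau> + (0, l, 2 * (l \<bullet> m)) \<in> V"
    by (rule subspace_add[OF V])
  then have c: "(1, c, v1) \<in> V"
    using u0 by (simp add: \<tau>_eq c_def c0_def v1_def)
  define \<rho> where "\<rho> = v1 - c \<bullet> c"
  have mem: "(u, x, v) \<in> V \<longleftrightarrow> (u, x, v) \<in> sphere_space c L \<rho>" for u x v
  proof
    assume "(u, x, v) \<in> V"
    from subspace_diff[OF V this subspace_scale[OF V c, of u]]
    have *: "(0, x - u *\<^sub>R c, v - u * v1) \<in> V"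
      by simp
    then have "x - u *\<^sub>R c \<in> L"
      using height by (simp add: L_def)
    with height[OF *] show "(u, x, v) \<in> sphere_space c L \<rho>"
      by (simp add: mem_sphere_space \<rho>_def ym)
  next
    assume "(u, x, v) \<in> sphere_space c L \<rho>"
    then have *: "x - u *\<^sub>R c \<in> L" "v = u * v1 + 2 * ((x - u *\<^sub>R c) \<bullet> m)"
      by (simp_all add: mem_sphere_space \<rho>_def ym)
    then have "(0, x - u *\<^sub>R c, 2 * ((x - u *\<^sub>R c) \<bullet> m)) \<in> V"
      by (simp add: L_def)
    from subspace_add[OF V this subspace_scale[OF V c, of u]] show "(u, x, v) \<in> V"
      using * by (simp add: add.commute)
  qed
  then have V_eq: "V = sphere_space c L \<rho>"
    by (simp add: set_eq_iff)
  have "\<tau> \<in> sphere_space c L \<rho>"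
    using \<tau>(1) V_eq by simp
  then obtain u y where "\<tau> = (u, u *\<^sub>R c + y, u * (c \<bullet> c + \<rho>) + 2 * (y \<bullet> c))"
    by (auto simp: sphere_space_def)
  then have "cone_form \<tau> = y \<bullet> y - \<rho> * u\<^sup>2"
    by (simp add: cone_form_def algebra_simps inner_add_left inner_add_right inner_commute power2_eq_square)
  then have "\<rho> * u\<^sup>2 > 0"
    using \<tau>(2) inner_ge_zero[of y] by linarith
  then have "\<rho> > 0"
    by (simp add: zero_less_mult_iff)
  with L show ?thesis
    using V_eq by (rule that)
qed

text \<open>Spheres and planes are the two kinds of sections by Lorentzian subspaces; the planes are
  those that pass through infinity.\<close>

theorem spheres_and_planes_iff_section:
  fixes S :: "'a::euclidean_space set"
  shows "S \<in> round_spheres d \<union> affine_planes d \<longleftrightarrow>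
    (\<exists>V. subspace V \<and> dim V = d + 2 \<and> (\<exists>\<xi>\<in>V. cone_form \<xi> < 0) \<and> S = section_of_paraboloid V)"
proof
  assume "S \<in> round_spheres d \<union> affine_planes d"
  then show "\<exists>V. subspace V \<and> dim V = d + 2 \<and> (\<exists>\<xi>\<in>V. cone_form \<xi> < 0) \<and> S = section_of_paraboloid V"
  proof
    assume "S \<in> round_spheres d"
    then obtain c L \<rho> where L: "subspace L" "dim L = d + 1" "\<rho> > 0"
        "S = {x. x - c \<in> L \<and> (norm (x - c))\<^sup>2 = \<rho>}"
      by (auto simp: round_spheres_iff)
    have "(1, c, c \<bullet> c + \<rho>) \<in> sphere_space c L \<rho>" "cone_form (1, c, c \<bullet> c + \<rho>) < 0"
      using L by (simp_all add: mem_sphere_space subspace_0 cone_form_def)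
    with L show ?thesis
      by (intro exI[of _ "sphere_space c L \<rho>"])
        (auto simp: subspace_sphere_space dim_sphere_space section_of_sphere_space)
  next
    assume "S \<in> affine_planes d"
    then obtain c L where L: "subspace L" "dim L = d" "S = {x. x - c \<in> L}"
      by (auto simp: affine_planes_iff)
    have "(1, c, c \<bullet> c + 1) \<in> plane_space c L" "cone_form (1, c, c \<bullet> c + 1) < 0"
      using L by (simp_all add: mem_plane_space subspace_0 cone_form_def)
    with L show ?thesis
      by (intro exI[of _ "plane_space c L"])
        (auto simp: subspace_plane_space dim_plane_space section_of_plane_space)
  qed
next
  assume "\<exists>V. subspace V \<and> dim V = d + 2 \<and> (\<exists>\<xi>\<in>V. cone_form \<xi> < 0) \<and> S = section_of_paraboloid V"
  then obtain V \<tau> where V: "subspace V" "dim V = d + 2" and \<tau>: "\<tau> \<in> V" "cone_form \<tau> < 0"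
    and S: "S = section_of_paraboloid V"
    by blast
  show "S \<in> round_spheres d \<union> affine_planes d"
  proof (cases "(0, 0, 1) \<in> V")
    case True
    obtain c L where L: "subspace L" "V = plane_space c L"
      by (rule lorentzian_subspace_with_infinity[OF V(1) \<tau> True]) (rule that)
    then have "dim L = d"
      using V(2) by (simp add: dim_plane_space)
    with L S show ?thesis
      by (auto simp: affine_planes_iff section_of_plane_space)
  next
    case False
    obtain c L \<rho> where L: "subspace L" "\<rho> > 0" "V = sphere_space c L \<rho>"
      by (rule lorentzian_subspace_without_infinity[OF V(1) \<tau> False]) (rule that)
    then have "dim L = d + 1"
      using V(2) by (simp add: dim_sphere_space)
    with L S show ?thesis
      by (auto simp: round_spheres_iff section_of_sphere_space)
  qed
qed

section \<open>The null lines of a subspace\<close>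

lemma span_singleton_scaleR:
  fixes \<xi> :: "'a::real_vector"
  assumes "c \<noteq> 0"
  shows "span {c *\<^sub>R \<xi>} = span {\<xi>}"
proof
  show "span {c *\<^sub>R \<xi>} \<subseteq> span {\<xi>}"
    by (intro span_minimal) (auto simp: span_scale span_base)
  have "(1 / c) *\<^sub>R c *\<^sub>R \<xi> \<in> span {c *\<^sub>R \<xi>}"
    by (intro span_scale span_base) simp
  then show "span {\<xi>} \<subseteq> span {c *\<^sub>R \<xi>}"
    using assms by (intro span_minimal) auto
qed

text \<open>The points of the quadric on the projective subspace of \<open>W\<close>.\<close>

definition null_lines :: "nat \<Rightarrow> 'n::{finite,linorder} ambient set \<Rightarrow> 'n ambient set set" where
  "null_lines p W = {span {\<xi>} | \<xi>. \<xi> \<in> W \<and> \<xi> \<noteq> 0 \<and> quad_form_hat p \<xi> = 0}"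

lemma null_linesI:
  "\<xi> \<in> W \<Longrightarrow> \<xi> \<noteq> 0 \<Longrightarrow> quad_form_hat p \<xi> = 0 \<Longrightarrow> span {\<xi>} \<in> null_lines p W"
  unfolding null_lines_def by blast

lemma null_linesE:
  assumes "l \<in> null_lines p W"
  obtains \<xi> where "\<xi> \<in> W" "\<xi> \<noteq> 0" "quad_form_hat p \<xi> = 0" "l = span {\<xi>}"
  using assms unfolding null_lines_def by blast

lemma quadric_eq_null_lines: "quadric p = null_lines p UNIV"
  by (simp add: quadric_def null_lines_def)

lemma null_lines_subset_quadric: "null_lines p W \<subseteq> quadric p"
  by (auto simp: quadric_def null_lines_def)

lemma proj_map_image_null_lines:
  fixes g :: "'n::{finite,linorder} ambient \<Rightarrow> 'n ambient"
  assumes "form_isometry (quad_form_hat p) g"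
  shows "proj_map g ` null_lines p W = null_lines p (g ` W)"
proof -
  have g: "linear g" "inj g" "\<And>\<xi>. quad_form_hat p (g \<xi>) = quad_form_hat p \<xi>"
    using assms by (auto simp: form_isometry_def bij_is_inj)
  have zero: "g \<xi> = 0 \<longleftrightarrow> \<xi> = 0" for \<xi>
    using linear_0[OF g(1)] injD[OF g(2), of \<xi> 0] by auto
  show ?thesis
  proof (intro equalityI subsetI)
    fix l assume "l \<in> proj_map g ` null_lines p W"
    then obtain k where "k \<in> null_lines p W" and l: "l = proj_map g k"
      by blast
    then obtain \<xi> where \<xi>: "\<xi> \<in> W" "\<xi> \<noteq> 0" "quad_form_hat p \<xi> = 0" "k = span {\<xi>}"
      by (elim null_linesE)
    then have "span {g \<xi>} \<in> null_lines p (g ` W)"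
      using zero g(3) by (intro null_linesI) auto
    then show "l \<in> null_lines p (g ` W)"
      by (simp add: l \<xi>(4) proj_map_span[OF g(1)])
  next
    fix l assume "l \<in> null_lines p (g ` W)"
    then obtain \<xi> where \<xi>: "\<xi> \<in> W" "g \<xi> \<noteq> 0" "quad_form_hat p (g \<xi>) = 0" and l: "l = span {g \<xi>}"
      by (auto elim!: null_linesE)
    have "span {\<xi>} \<in> null_lines p W"
      using \<xi> by (intro null_linesI) (simp_all add: zero g(3))
    moreover have "l = proj_map g (span {\<xi>})"
      by (simp add: l proj_map_span[OF g(1)])
    ultimately show "l \<in> proj_map g ` null_lines p W"
      by blast
  qed
qed

lemma closedin_null_lines:
  fixes W :: "'n::{finite,linorder} ambient set"
  assumes W: "subspace W"
  shows "closedin (quadric_topology p) (null_lines p W)"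
proof -
  define T where "T = {span {\<xi>} | \<xi>. \<xi> \<in> W \<and> \<xi> \<noteq> 0}"
  have mem: "\<xi> \<in> W" if "span {\<xi>} = span {\<eta>}" "\<eta> \<in> W" for \<xi> \<eta>
  proof -
    have "\<xi> \<in> span {\<eta>}"
      using that(1) span_base[of \<xi> "{\<xi>}"] by simp
    moreover have "span {\<eta>} \<subseteq> W"
      using W that(2) by (intro span_minimal) auto
    ultimately show ?thesis by blast
  qed
  have T_iff: "span {\<xi>} \<in> T \<longleftrightarrow> \<xi> \<in> W" if "\<xi> \<noteq> 0" for \<xi>
  proof
    assume "span {\<xi>} \<in> T"
    then obtain \<eta> where "span {\<xi>} = span {\<eta>}" "\<eta> \<in> W"
      unfolding T_def by blast
    then show "\<xi> \<in> W" by (rule mem)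
  qed (use that T_def in blast)
  have "\<xi> \<noteq> 0 \<and> span {\<xi>} \<in> projective_space - T \<longleftrightarrow> \<xi> \<notin> W" for \<xi>
  proof (cases "\<xi> = 0")
    case True
    then show ?thesis using subspace_0[OF W] by simp
  next
    case False
    then have "span {\<xi>} \<in> projective_space"
      unfolding projective_space_def by blast
    with False show ?thesis by (simp add: T_iff)
  qed
  then have "{\<xi>. \<xi> \<noteq> 0 \<and> span {\<xi>} \<in> projective_space - T} = - W"
    by (simp add: Compl_eq)
  then have "openin projective_topology (projective_space - T)"
    using closed_subspace[OF W] by (simp add: openin_projective_topology open_Compl)
  moreover have "T \<subseteq> projective_space"
    by (auto simp: T_def projective_space_def)
  ultimately have "closedin projective_topology T"
    by (simp add: closedin_def topspace_projective_topology)
  moreover have "null_lines p W = T \<inter> quadric p"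
  proof (intro equalityI subsetI)
    fix l assume "l \<in> null_lines p W"
    then show "l \<in> T \<inter> quadric p"
      unfolding null_lines_def quadric_def T_def by blast
  next
    fix l assume "l \<in> T \<inter> quadric p"
    then obtain \<xi> where "\<xi> \<noteq> 0" "quad_form_hat p \<xi> = 0" "l = span {\<xi>}" "span {\<xi>} \<in> T"
      by (auto simp: quadric_eq_null_lines elim: null_linesE)
    then show "l \<in> null_lines p W"
      using T_iff by (auto intro: null_linesI)
  qed
  ultimately show ?thesis
    by (auto simp: quadric_topology_def closedin_subtopology)
qed

lemma topspace_quadric_topology: "topspace (quadric_topology p) = quadric p"
  by (auto simp: quadric_topology_def topspace_projective_topology quadric_def projective_space_def)

section \<open>Coordinates in which the embedding is a paraboloid\<close>

text \<open>When the middle coordinates carry the form \<open>s (x \<bullet> x)\<close> with \<open>s = 1\<close> or \<open>s = - 1\<close>, these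
  coordinates, \<open>u = a + b\<close> and \<open>v = s (b - a)\<close>, turn the ambient form into \<open>s\<close> times
  \<open>cone_form\<close> and the embedded points into the points of the paraboloid. They treat the cases
  \<open>q = 0\<close> and \<open>p = 0\<close> alike.\<close>

definition paraboloid_chart ::
    "real \<Rightarrow> real \<times> (real, 'n) vec \<times> real \<Rightarrow> 'n::finite ambient" where
  "paraboloid_chart s = (\<lambda>(u, x, v). ((u - s * v) / 2, x, (u + s * v) / 2))"

lemma linear_paraboloid_chart: "linear (paraboloid_chart s)"
  by (rule linearI) (auto simp: paraboloid_chart_def algebra_simps add_divide_distrib diff_divide_distrib)

lemma bij_paraboloid_chart:
  assumes "s * s = 1"
  shows "bij (paraboloid_chart s)"
proof (rule o_bij)
  let ?f = "\<lambda>(a, x, b). (a + b, x, s * (b - a))"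
  have involution: "s * (s * v) = v" for v
    using assms by (metis mult.assoc mult_1)
  show "?f \<circ> paraboloid_chart s = id" "paraboloid_chart s \<circ> ?f = id"
    by (simp_all add: fun_eq_iff paraboloid_chart_def diff_divide_distrib[symmetric]
        add_divide_distrib[symmetric] involution assms)
qed

text \<open>Naming the form \<open>Q\<close> makes the index type of the coordinates part of the parameters.\<close>

locale definite_form =
  fixes p :: nat and s :: real and Q :: "(real, 'n::{finite,linorder}) vec \<Rightarrow> real"
  assumes Q_def: "Q = quad_form p"
    and sign: "s * s = 1"
    and quad_form_eq: "\<And>x. Q x = s * (x \<bullet> x)"
begin

abbreviation "chart \<equiv> (paraboloid_chart s :: _ \<Rightarrow> 'n ambient)"

lemma sign_nonzero: "s \<noteq> 0"
  using sign by auto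

lemma sign_cases: "s = 1 \<or> s = - 1"
  using sign by (simp add: square_eq_1_iff)

lemma quad_form_hat_chart: "quad_form_hat p (chart \<xi>) = s * cone_form \<xi>"
proof -
  obtain u x v where \<xi>: "\<xi> = (u, x, v)"
    by (metis prod_cases3)
  have "((u - s * v) / 2)\<^sup>2 - ((u + s * v) / 2)\<^sup>2 = - (s * (u * v))"
    by (simp add: power2_eq_square field_simps)
  moreover have "quad_form p x = s * (x \<bullet> x)"
    using quad_form_eq by (simp add: Q_def)
  ultimately show ?thesis
    by (simp add: \<xi> quad_form_hat_def paraboloid_chart_def cone_form_def right_diff_distrib)
qed

lemma quadric_embedding_chart: "quadric_embedding p x = span {chart (1, x, x \<bullet> x)}"
  using quad_form_eq by (simp add: quadric_embedding_def paraboloid_chart_def Q_def)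

lemma chart_eq_0_iff: "chart \<xi> = 0 \<longleftrightarrow> \<xi> = 0"
  using linear_paraboloid_chart bij_is_inj[OF bij_paraboloid_chart[OF sign]]
    linear_0 linear_injective_0 by metis

lemma null_lines_chart:
  "null_lines p (chart ` V) = {span {chart \<xi>} | \<xi>. \<xi> \<in> V \<and> \<xi> \<noteq> 0 \<and> cone_form \<xi> = 0}"
proof (intro equalityI subsetI)
  fix l assume "l \<in> null_lines p (chart ` V)"
  then show "l \<in> {span {chart \<xi>} | \<xi>. \<xi> \<in> V \<and> \<xi> \<noteq> 0 \<and> cone_form \<xi> = 0}"
    using sign_nonzero by (elim null_linesE imageE) (metis (mono_tags, lifting)
        chart_eq_0_iff mem_Collect_eq mult_eq_0_iff quad_form_hat_chart)
next
  fix l assume "l \<in> {span {chart \<xi>} | \<xi>. \<xi> \<in> V \<and> \<xi> \<noteq> 0 \<and> cone_form \<xi> = 0}"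
  then obtain \<xi> where "l = span {chart \<xi>}" "\<xi> \<in> V" "\<xi> \<noteq> 0" "cone_form \<xi> = 0"
    by blast
  then show "l \<in> null_lines p (chart ` V)"
    by (auto simp only: quad_form_hat_chart chart_eq_0_iff mult_zero_right intro!: null_linesI imageI)
qed

lemma embedding_section_subset:
  "quadric_embedding p ` section_of_paraboloid V \<subseteq> null_lines p (chart ` V)"
proof
  fix l assume "l \<in> quadric_embedding p ` section_of_paraboloid V"
  then obtain x where x: "(1, x, x \<bullet> x) \<in> V" "l = span {chart (1, x, x \<bullet> x)}"
    by (auto simp: section_of_paraboloid_def quadric_embedding_chart)
  moreover have "cone_form (1, x, x \<bullet> x) = 0" "(1 :: real, x, x \<bullet> x) \<noteq> 0"
    by (simp_all add: cone_form_def zero_prod_def)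
  ultimately show "l \<in> null_lines p (chart ` V)"
    unfolding null_lines_chart by blast
qed

text \<open>On the line \<open>c + y / t\<close> in the plane, the lift of a point multiplied by \<open>t\<^sup>2\<close> is a
  polynomial in \<open>t\<close>, whose value at \<open>t = 0\<close> is a nonzero multiple of \<open>(0, 0, 1)\<close>. So the point
  at infinity is a limit of points of the plane.\<close>

lemma infinity_in_closure:
  assumes V: "subspace V" and inf: "(0, 0, 1) \<in> V"
    and c: "(1, c, 0) \<in> V" and y: "(0, y, 0) \<in> V" "y \<noteq> 0"
  shows "span {chart (0, 0, 1)} \<in>
    quadric_topology p closure_of (quadric_embedding p ` section_of_paraboloid V)"
proof -
  let ?inf = "span {chart (0, 0, 1)}"
  define \<gamma> where "\<gamma> t = chart (t\<^sup>2, t\<^sup>2 *\<^sub>R c + t *\<^sub>R y, (t *\<^sub>R c + y) \<bullet> (t *\<^sub>R c + y))" for t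
  have cont: "continuous_on UNIV \<gamma>"
    unfolding \<gamma>_def paraboloid_chart_def by (auto intro!: continuous_intros)
  have \<gamma>0: "span {\<gamma> 0} = ?inf"
  proof -
    have "\<gamma> 0 = (y \<bullet> y) *\<^sub>R chart (0, 0, 1)"
      by (simp add: \<gamma>_def paraboloid_chart_def)
    with y(2) show ?thesis
      by (simp add: span_singleton_scaleR)
  qed
  have \<gamma>: "span {\<gamma> t} \<in> quadric_embedding p ` section_of_paraboloid V" if "t \<noteq> 0" for t
  proof -
    let ?x = "c + (1 / t) *\<^sub>R y"
    have "\<gamma> t = t\<^sup>2 *\<^sub>R chart (1, ?x, ?x \<bullet> ?x)"
    proof -
      have "t *\<^sub>R c + y = t *\<^sub>R ?x"
        using that by (simp add: scaleR_add_right)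
      then have "(t *\<^sub>R c + y) \<bullet> (t *\<^sub>R c + y) = t\<^sup>2 * (?x \<bullet> ?x)"
        by (simp add: power2_eq_square mult.assoc)
      moreover have "t\<^sup>2 *\<^sub>R c + t *\<^sub>R y = t\<^sup>2 *\<^sub>R ?x"
        using that by (simp add: scaleR_add_right power2_eq_square)
      ultimately have "(t\<^sup>2, t\<^sup>2 *\<^sub>R c + t *\<^sub>R y, (t *\<^sub>R c + y) \<bullet> (t *\<^sub>R c + y)) = t\<^sup>2 *\<^sub>R (1, ?x, ?x \<bullet> ?x)"
        by simp
      then show ?thesis
        unfolding \<gamma>_def by (simp only: linear_scale[OF linear_paraboloid_chart])
    qed
    then have "span {\<gamma> t} = quadric_embedding p ?x"
      using that by (simp add: span_singleton_scaleR quadric_embedding_chart)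
    moreover have "(1, c, 0) + (1 / t) *\<^sub>R (0, y, 0) + (?x \<bullet> ?x) *\<^sub>R (0, 0, 1) \<in> V"
      by (intro subspace_add subspace_scale V c y inf)
    then have "?x \<in> section_of_paraboloid V"
      by (simp add: section_of_paraboloid_def)
    ultimately show ?thesis by blast
  qed
  show ?thesis
    unfolding in_closure_of
  proof (intro conjI allI impI)
    have "?inf \<in> null_lines p (chart ` V)"
      unfolding null_lines_chart using inf
      by (intro CollectI exI[of _ "(0, 0, 1)"]) (simp add: cone_form_def zero_prod_def)
    then show "?inf \<in> topspace (quadric_topology p)"
      using null_lines_subset_quadric by (auto simp: topspace_quadric_topology)
    fix T assume T: "?inf \<in> T \<and> openin (quadric_topology p) T"
    then obtain T' where T': "openin projective_topology T'" "T = T' \<inter> quadric p"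
      by (auto simp: quadric_topology_def openin_subtopology)
    let ?P = "{\<xi>. \<xi> \<noteq> 0 \<and> span {\<xi>} \<in> T'}"
    have "open (\<gamma> -` ?P)"
      using T'(1) by (intro open_vimage[OF _ cont]) (simp add: openin_projective_topology)
    moreover have "(0 :: real, 0 :: (real, 'n) vec, y \<bullet> y) \<noteq> 0"
      using y(2) by (simp add: zero_prod_def)
    then have "\<gamma> 0 \<noteq> 0"
      by (simp add: \<gamma>_def chart_eq_0_iff)
    then have "0 \<in> \<gamma> -` ?P"
      using T T'(2) \<gamma>0 by simp
    ultimately have "\<gamma> -` ?P \<noteq> {0}" "0 \<in> \<gamma> -` ?P"
      using not_open_singleton[of "0::real"] by metis+
    then obtain t where "t \<noteq> 0" "t \<in> \<gamma> -` ?P"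
      by blast
    moreover from this \<gamma> have "span {\<gamma> t} \<in> quadric p"
      using embedding_section_subset null_lines_subset_quadric by blast
    ultimately show "\<exists>l. l \<in> quadric_embedding p ` section_of_paraboloid V \<and> l \<in> T"
      using \<gamma>[of t] T'(2) by blast
  qed
qed

text \<open>The null lines of \<open>V\<close> form a closed set that consists of the embedded section and possibly
  the point at infinity. The hypothesis on \<open>V\<close> says that a section whose subspace contains
  infinity contains a line, so that infinity is a limit; it excludes the section with a single
  point.\<close>

lemma closure_of_embedded_section:
  assumes V: "subspace V"
    and inf: "(0, 0, 1) \<in> V \<Longrightarrow> \<exists>c y. y \<noteq> 0 \<and> (1, c, 0) \<in> V \<and> (0, y, 0) \<in> V"
  shows "quadric_topology p closure_of (quadric_embedding p ` section_of_paraboloid V) =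
    null_lines p (chart ` V)" (is "?C = _")
proof
  have "subspace (chart ` V)"
    by (rule linear_subspace_image[OF linear_paraboloid_chart V])
  then show "?C \<subseteq> null_lines p (chart ` V)"
    by (intro closure_of_minimal embedding_section_subset closedin_null_lines)
  show "null_lines p (chart ` V) \<subseteq> ?C"
  proof
    fix l assume "l \<in> null_lines p (chart ` V)"
    then obtain u x v where \<xi>: "(u, x, v) \<in> V" "(u, x, v) \<noteq> 0" "x \<bullet> x = u * v"
      and l: "l = span {chart (u, x, v)}"
      by (auto simp: null_lines_chart cone_form_def split: prod.splits)
    show "l \<in> ?C"
    proof (cases "u = 0")
      case True
      with \<xi> have "x = 0" "v \<noteq> 0"
        by (auto simp: zero_prod_def)
      have "(0, 0, 1) = (1 / v) *\<^sub>R (u, x, v)" "(u, x, v) = v *\<^sub>R (0, 0, 1)"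
        using True \<open>x = 0\<close> \<open>v \<noteq> 0\<close> by simp_all
      then have "(0, 0, 1) \<in> V" and "l = span {chart (0, 0, 1)}"
        using subspace_scale[OF V \<xi>(1)] \<open>v \<noteq> 0\<close>
        by (metis, metis l linear_scale[OF linear_paraboloid_chart] span_singleton_scaleR)
      with inf V show ?thesis
        using infinity_in_closure by blast
    next
      case False
      let ?x = "(1 / u) *\<^sub>R x"
      have "?x \<bullet> ?x = v / u"
        using False \<xi>(3) by simp
      then have *: "(1, ?x, ?x \<bullet> ?x) = (1 / u) *\<^sub>R (u, x, v)"
        using False by simp
      then have "?x \<in> section_of_paraboloid V"
        unfolding section_of_paraboloid_def mem_Collect_eq *
        by (intro subspace_scale V \<xi>(1))
      moreover have "l = quadric_embedding p ?x"
        unfolding l quadric_embedding_chart * linear_scale[OF linear_paraboloid_chart]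
        using False by (simp add: span_singleton_scaleR)
      ultimately have "l \<in> quadric_embedding p ` section_of_paraboloid V"
        by blast
      moreover have "quadric_embedding p ` section_of_paraboloid V \<subseteq> ?C"
        by (rule closure_of_subset)
          (auto simp: topspace_quadric_topology quadric_embedding_in_quadric)
      ultimately show ?thesis by blast
    qed
  qed
qed

text \<open>In this description no trace of the embedding is left, so the invariance under the
  orthogonal group is immediate.\<close>

theorem spheres_and_planes_eq_null_lines:
  assumes "d \<ge> 1"
  shows "(spheres_and_planes p d :: 'n ambient set set set) =
    {null_lines p W | W. subspace W \<and> dim W = d + 2 \<and> (\<exists>\<xi>\<in>W. s * quad_form_hat p \<xi> < 0)}"
    (is "_ = ?R")
proof -
  note chart = linear_paraboloid_chart[of s] bij_paraboloid_chart[OF sign]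
  have dim: "dim (chart ` V) = dim V" for V :: "(real \<times> (real, 'n) vec \<times> real) set"
    using chart by (intro dim_image_eq) (auto intro: inj_on_subset bij_is_inj)
  have timelike: "s * quad_form_hat p (chart \<xi>) = cone_form \<xi>" for \<xi>
    by (simp add: quad_form_hat_chart mult.assoc[symmetric] sign)
  have closure: "quadric_topology p closure_of (quadric_embedding p ` section_of_paraboloid V) =
      null_lines p (chart ` V)"
    if V: "subspace V" "dim V = d + 2" "\<exists>\<xi>\<in>V. cone_form \<xi> < 0"
    for V :: "(real \<times> (real, 'n) vec \<times> real) set"
  proof (rule closure_of_embedded_section[OF V(1)])
    assume inf: "(0, 0, 1) \<in> V"
    obtain \<tau> where \<tau>: "\<tau> \<in> V" "cone_form \<tau> < 0"
      using V(3) by blast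
    obtain c L where L: "subspace L" "V = plane_space c L"
      by (rule lorentzian_subspace_with_infinity[OF V(1) \<tau> inf]) (rule that)
    then have "dim L \<noteq> 0"
      using V(2) assms by (simp add: dim_plane_space)
    then obtain y where "y \<in> L" "y \<noteq> 0"
      by (metis dim_eq_0 singletonI subsetI)
    then have "y \<noteq> 0 \<and> (1, c, 0) \<in> V \<and> (0, y, 0) \<in> V"
      using L by (simp add: mem_plane_space subspace_0)
    then show "\<exists>c y. y \<noteq> 0 \<and> (1, c, 0) \<in> V \<and> (0, y, 0) \<in> V"
      by blast
  qed
  show ?thesis
  proof (intro equalityI subsetI)
    fix A :: "'n ambient set set" assume "A \<in> spheres_and_planes p d"
    then obtain S where S: "S \<in> round_spheres d \<union> affine_planes d"
      and A: "A = quadric_topology p closure_of (quadric_embedding p ` S)"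
      by (auto simp: spheres_and_planes_def)
    obtain V where V: "subspace V" "dim V = d + 2" "\<exists>\<xi>\<in>V. cone_form \<xi> < 0"
      and "S = section_of_paraboloid V"
      using S unfolding spheres_and_planes_iff_section by blast
    then have "A = null_lines p (chart ` V)"
      using closure A by simp
    moreover have "subspace (chart ` V)"
      by (rule linear_subspace_image[OF chart(1) V(1)])
    moreover have "dim (chart ` V) = d + 2" "\<exists>\<xi>\<in>chart ` V. s * quad_form_hat p \<xi> < 0"
      using V(2,3) by (simp_all add: dim timelike)
    ultimately show "A \<in> ?R"
      by blast
  next
    fix A assume "A \<in> ?R"
    then obtain W where W: "subspace W" "dim W = d + 2" "\<exists>\<xi>\<in>W. s * quad_form_hat p \<xi> < 0"
      and A: "A = null_lines p W"
      by blast
    define V where "V = chart -` W"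
    have W_eq: "W = chart ` V"
      by (simp add: V_def bij_is_surj[OF chart(2)])
    have V: "subspace V" "dim V = d + 2" "\<exists>\<xi>\<in>V. cone_form \<xi> < 0"
    proof -
      show "subspace V"
        unfolding V_def by (rule linear_subspace_vimage[OF chart(1) W(1)])
      show "dim V = d + 2" "\<exists>\<xi>\<in>V. cone_form \<xi> < 0"
        using W(2,3) unfolding W_eq by (simp_all add: dim timelike)
    qed
    then have "section_of_paraboloid V \<in> round_spheres d \<union> affine_planes d"
      unfolding spheres_and_planes_iff_section by blast
    moreover have "A = quadric_topology p closure_of (quadric_embedding p ` section_of_paraboloid V)"
      using closure[OF V] A W_eq by simp
    ultimately show "A \<in> spheres_and_planes p d"
      unfolding spheres_and_planes_def by blast
  qed
qed

lemma orthogonal_group_transitive_on_subspaces: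
  fixes W W' :: "'n ambient set"
  assumes W: "subspace W" "\<exists>\<xi>\<in>W. s * quad_form_hat p \<xi> < 0"
    and W': "subspace W'" "\<exists>\<xi>\<in>W'. s * quad_form_hat p \<xi> < 0" and dim: "dim W = dim W'"
  shows "\<exists>g. form_isometry (quad_form_hat p) g \<and> g ` W = W'"
proof -
  \<comment> \<open>The coordinate axis whose sign in \<open>s * quad_form_hat p\<close> is negative: the last one for
    \<open>s = 1\<close>, the first one for \<open>s = - 1\<close>.\<close>
  define \<tau> :: "'n ambient" where "\<tau> = (if s = 1 then (0, 0, 1) else (1, 0, 0))"
  have "norm \<tau> = 1"
    by (simp add: \<tau>_def norm_prod_def)
  have eq: "s * quad_form_hat p \<xi> = lorentz_form \<tau> \<xi> \<xi>" for \<xi>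
    using sign_cases quad_form_eq
    by (cases \<xi>) (auto simp: quad_form_hat_def Q_def \<tau>_def lorentz_form_def power2_eq_square)
  obtain g where g: "lorentz_isometry \<tau> g" "g ` W = W'"
    using lorentz_isometries_transitive[OF \<open>norm \<tau> = 1\<close> W(1) _ W'(1) _ dim] W(2) W'(2)
    by (auto simp: eq)
  have "form_isometry (quad_form_hat p) g"
    using g(1) sign_nonzero by (simp add: form_isometry_def eq[symmetric])
  with g(2) show ?thesis by blast
qed

end

lemma definite_form_if_single_sign:
  assumes "CARD('n::{finite,linorder}) = p + q" "p = 0 \<or> q = 0"
  obtains s where "definite_form p s (quad_form p :: (real, 'n) vec \<Rightarrow> real)"
  using assms(2)
proof
  assume "p = 0"
  then have "definite_form p (- 1) (quad_form p :: (real, 'n) vec \<Rightarrow> real)"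
    by unfold_locales (auto simp: quad_form_def inner_vec_def power2_eq_square sum_negf)
  then show ?thesis by (rule that)
next
  assume "q = 0"
  have "card {j. j < i} < p" for i :: 'n
    using psubset_card_mono[of "UNIV :: 'n set" "{j. j < i}"] assms(1) \<open>q = 0\<close> by auto
  then have "definite_form p 1 (quad_form p :: (real, 'n) vec \<Rightarrow> real)"
    by unfold_locales (auto simp: quad_form_def inner_vec_def power2_eq_square)
  then show ?thesis by (rule that)
qed

section \<open>Group actions\<close>

lemma carrier_orthogonal_group:
  "g \<in> carrier (orthogonal_group p) \<longleftrightarrow> form_isometry (quad_form_hat p) g"
  by (simp add: orthogonal_group_def form_isometry_def)

lemma group_orthogonal_group: "group (orthogonal_group p :: ('n::{finite,linorder} ambient \<Rightarrow> _) monoid)"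
proof (rule groupI)
  fix g :: "'n ambient \<Rightarrow> 'n ambient"
  assume g: "g \<in> carrier (orthogonal_group p)"
  then have "inj g"
    by (simp add: carrier_orthogonal_group form_isometry_def bij_is_inj)
  then have "inv_into UNIV g \<circ> g = id"
    by simp
  moreover have "inv_into UNIV g \<in> carrier (orthogonal_group p)"
    using g by (simp add: carrier_orthogonal_group form_isometry_inv)
  ultimately show "\<exists>h\<in>carrier (orthogonal_group p). h \<otimes>\<^bsub>orthogonal_group p\<^esub> g = \<one>\<^bsub>orthogonal_group p\<^esub>"
    by (auto simp: orthogonal_group_def)
next
  fix g h :: "'n ambient \<Rightarrow> 'n ambient"
  assume "g \<in> carrier (orthogonal_group p)" "h \<in> carrier (orthogonal_group p)"
  then have "g \<circ> h \<in> carrier (orthogonal_group p)"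
    by (simp add: carrier_orthogonal_group form_isometry_comp)
  then show "g \<otimes>\<^bsub>orthogonal_group p\<^esub> h \<in> carrier (orthogonal_group p)"
    by (simp add: orthogonal_group_def)
next
  have "id \<in> carrier (orthogonal_group p)"
    by (simp add: carrier_orthogonal_group form_isometry_id)
  then show "\<one>\<^bsub>orthogonal_group p\<^esub> \<in> carrier (orthogonal_group p)"
    by (simp add: orthogonal_group_def)
qed (simp_all add: orthogonal_group_def comp_assoc)

lemma group_actionI:
  fixes G (structure)
  assumes "group G"
    and closed: "\<And>g x. g \<in> carrier G \<Longrightarrow> x \<in> E \<Longrightarrow> f g x \<in> E"
    and mult: "\<And>g h x. g \<in> carrier G \<Longrightarrow> h \<in> carrier G \<Longrightarrow> x \<in> E \<Longrightarrow> f (g \<otimes> h) x = f g (f h x)"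
    and one: "\<And>x. x \<in> E \<Longrightarrow> f \<one> x = x"
  shows "group_action G E (\<lambda>g. \<lambda>x\<in>E. f g x)"
proof -
  interpret group G by fact
  have Bij: "(\<lambda>x\<in>E. f g x) \<in> Bij E" if g: "g \<in> carrier G" for g
  proof -
    have "f (inv g) (f g x) = x" "f g (f (inv g) x) = x" if "x \<in> E" for x
      using g that mult[of "inv g" g x] mult[of g "inv g" x] by (simp_all add: one)
    then have "bij_betw (f g) E E"
      using g closed by (intro bij_betw_byWitness[where f' = "f (inv g)"]) auto
    then have "bij_betw (\<lambda>x\<in>E. f g x) E E"
      using bij_betw_cong[of E "\<lambda>x\<in>E. f g x" "f g"] by simp
    then show ?thesis
      by (simp add: Bij_def)
  qed
  show ?thesis
  proof (intro group_action.intro group_hom.intro group_hom_axioms.intro homI)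
    show "group G" by fact
    show "group (BijGroup E)" by (rule group_BijGroup)
    show "(\<lambda>x\<in>E. f g x) \<in> carrier (BijGroup E)" if "g \<in> carrier G" for g
      using Bij[OF that] by (simp add: BijGroup_def)
    show "(\<lambda>x\<in>E. f (g \<otimes> h) x) = (\<lambda>x\<in>E. f g x) \<otimes>\<^bsub>BijGroup E\<^esub> (\<lambda>x\<in>E. f h x)"
      if "g \<in> carrier G" "h \<in> carrier G" for g h
      using that Bij closed mult by (auto simp: BijGroup_def compose_def fun_eq_iff)
  qed
qed

theorem theorem17:
  fixes p q d :: nat
  assumes "CARD('n::{finite,linorder}) = p + q"
    and "p + q \<ge> 2"
    and "p = 0 \<or> q = 0"
    and "d \<in> {1..p + q - 1}"
  shows "group_action (orthogonal_group p) (quadric p :: 'n ambient set set)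
           (\<lambda>g. \<lambda>L\<in>quadric p. proj_map g L)
       \<and> transitive_action (orthogonal_group p) (spheres_and_planes p d :: 'n ambient set set set)
           (\<lambda>g. \<lambda>A\<in>spheres_and_planes p d. proj_map g ` A)
       \<and> (\<forall>g \<in> carrier (orthogonal_group p).
            \<forall>A \<in> (spheres_and_planes p d :: 'n ambient set set set).
              proj_map g ` A \<in> spheres_and_planes p d)
       \<and> (\<forall>A \<in> (spheres_and_planes p d :: 'n ambient set set set).
            \<forall>B \<in> spheres_and_planes p d.
              \<exists>g \<in> carrier (orthogonal_group p). proj_map g ` A = B)"
proof -
  let ?G = "orthogonal_group p :: ('n ambient \<Rightarrow> 'n ambient) monoid"
  let ?E = "spheres_and_planes p d :: 'n ambient set set set"
  obtain s where "definite_form p s (quad_form p :: (real, 'n) vec \<Rightarrow> real)"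
    using definite_form_if_single_sign assms(1,3) by blast
  then interpret definite_form p s "quad_form p :: (real, 'n) vec \<Rightarrow> real" .
  have E: "?E = {null_lines p W | W. subspace W \<and> dim W = d + 2 \<and> (\<exists>\<xi>\<in>W. s * quad_form_hat p \<xi> < 0)}"
    using assms(4) by (intro spheres_and_planes_eq_null_lines) simp
  have mult: "proj_map (g \<otimes>\<^bsub>?G\<^esub> h) L = proj_map g (proj_map h L)" for g h L
    by (simp add: orthogonal_group_def proj_map_def image_comp)
  have one: "proj_map \<one>\<^bsub>?G\<^esub> L = L" for L
    by (simp add: orthogonal_group_def proj_map_def)
  have invariant: "proj_map g ` A \<in> ?E" if g: "g \<in> carrier ?G" and "A \<in> ?E" for g A
  proof -
    obtain W where W: "subspace W" "dim W = d + 2" "\<exists>\<xi>\<in>W. s * quad_form_hat p \<xi> < 0"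
      and A: "A = null_lines p W"
      using \<open>A \<in> ?E\<close> unfolding E by blast
    have iso: "form_isometry (quad_form_hat p) g"
      using g by (simp add: carrier_orthogonal_group)
    then have "subspace (g ` W)"
      using W(1) by (simp add: form_isometry_def linear_subspace_image)
    moreover have "\<exists>\<xi>\<in>g ` W. s * quad_form_hat p \<xi> < 0"
      using W(3) iso unfolding form_isometry_def by (metis imageI)
    moreover have "dim (g ` W) = d + 2"
      using form_isometry_dim_image[OF iso] W(2) by simp
    ultimately show ?thesis
      unfolding E A proj_map_image_null_lines[OF iso] by blast
  qed
  have transitive: "\<exists>g\<in>carrier ?G. proj_map g ` A = B" if "A \<in> ?E" "B \<in> ?E" for A B
  proof -
    obtain W where W: "subspace W" "dim W = d + 2" "\<exists>\<xi>\<in>W. s * quad_form_hat p \<xi> < 0"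
      and A: "A = null_lines p W"
      using \<open>A \<in> ?E\<close> unfolding E by blast
    obtain W' where W': "subspace W'" "dim W' = d + 2" "\<exists>\<xi>\<in>W'. s * quad_form_hat p \<xi> < 0"
      and B: "B = null_lines p W'"
      using \<open>B \<in> ?E\<close> unfolding E by blast
    obtain g where g: "form_isometry (quad_form_hat p) g" "g ` W = W'"
      using orthogonal_group_transitive_on_subspaces[OF W(1,3) W'(1,3)] W(2) W'(2) by auto
    show ?thesis
    proof (rule bexI)
      show "proj_map g ` A = B"
        by (simp add: A B proj_map_image_null_lines[OF g(1)] g(2))
      show "g \<in> carrier ?G"
        using g(1) by (simp add: carrier_orthogonal_group)
    qed
  qed
  have "group_action ?G (quadric p) (\<lambda>g. \<lambda>L\<in>quadric p. proj_map g L)"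
  proof (rule group_actionI[OF group_orthogonal_group])
    fix g and L :: "'n ambient set"
    assume "g \<in> carrier ?G" "L \<in> quadric p"
    then have iso: "form_isometry (quad_form_hat p) g" and L: "L \<in> null_lines p UNIV"
      by (simp_all add: carrier_orthogonal_group quadric_eq_null_lines)
    from L have "proj_map g L \<in> null_lines p (g ` UNIV)"
      unfolding proj_map_image_null_lines[OF iso, symmetric] by (rule imageI)
    then show "proj_map g L \<in> quadric p"
      using null_lines_subset_quadric by blast
  qed (simp_all add: mult one)
  moreover have "group_action ?G ?E (\<lambda>g. \<lambda>A\<in>?E. proj_map g ` A)"
    using invariant
    by (intro group_actionI[OF group_orthogonal_group]) (simp_all add: mult one image_image)
  then have "transitive_action ?G ?E (\<lambda>g. \<lambda>A\<in>?E. proj_map g ` A)"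
    using transitive by (auto intro!: transitive_action.intro transitive_action_axioms.intro)
  ultimately show ?thesis
    using invariant transitive by blast
qed

end
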